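(* Let $\mathcal{N}(z)$ be a point-to-point LTI network over a field $\mathbb{F}$ with $v$ relays, channel matrices $H_{i,j}$, relay gains $K_1,\dots,K_v$ and transfer matrix $G(z,K)$. Let $d_{ax}$ be a positive integer, and let $K_{tx}$ (of size $d_{tx}\times d_{ax}$) and $K_{rx}$ (of size $d_{ax}\times d_{rx}$) be matrices, where all entries of $K_{tx},K_{rx},K_1,\dots,K_v$ are pairwise distinct independent indeterminates. Let $d=d_{rx}+\sum_{i=1}^vd_{i,out}$ and $$G_{lin}(z,K)=\begin{bmatrix}0&-K_{rx}&0&\cdots&0\\-H_{tx,rx}K_{tx}&I_{d_{rx}}&-H_{1,rx}K_1&\cdots&-H_{v,rx}K_v\\-H_{tx,1}K_{tx}&0&I_{d_{1,out}}-H_{1,1}K_1&\cdots&-H_{v,1}K_v\\ \vdots&\vdots&\vdots&\ddots&\vdots\\-H_{tx,v}K_{tx}&0&-H_{1,v}K_1&\cdots&I_{d_{v,out}}-H_{v,v}K_v\end{bmatrix}.$$ Then $\operatorname{rank}(K_{rx}G(z,K)K_{tx})+d=\operatorname{rank}G_{lin}(z,K)$.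
   Context: $\mathbb{F}(z)$ is the field of rational functions in $z$ over $\mathbb{F}$. A point-to-point LTI network $\mathcal{N}(z)$ has a transmitter $tx$ with $d_{tx}$ channel inputs, relays $1,\dots,v$ with $d_{i,in}$ channel inputs (sent signals) and $d_{i,out}$ channel outputs (received signals), a receiver $rx$ with $d_{rx}$ channel outputs, and arbitrary channel matrices $H_{i,j}$ over $\mathbb{F}(z)$ from $i\in\{tx,1,\dots,v\}$ to $j\in\{1,\dots,v,rx\}$ (rows = number of outputs of $j$, columns = number of inputs of $i$). Relay $i$ applies a $d_{i,in}\times d_{i,out}$ gain matrix $K_i$. The indeterminates are algebraically independent over $\mathbb{F}(z)$; $K$ denotes all of them, and ranks are over $\mathbb{F}(z,K)$. The transfer matrix is $$G(z,K)=H_{tx,rx}+\begin{bmatrix}H_{1,rx}K_1&\cdots&H_{v,rx}K_v\end{bmatrix}\left(I-\begin{bmatrix}H_{1,1}K_1&\cdots&H_{v,1}K_v\\ \vdots&\ddots&\vdots\\ H_{1,v}K_1&\cdots&H_{v,v}K_v\end{bmatrix}\right)^{-1}\begin{bmatrix}H_{tx,1}\\ \vdots\\ H_{tx,v}\end{bmatrix}.$$ *)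

theory Defs
  imports
    "HOL-Library.Poly_Mapping"
    "HOL-Computational_Algebra.Normalized_Fraction"
    "Jordan_Normal_Form.Gauss_Jordan_Elimination"
    "Jordan_Normal_Form.DL_Rank"
begin

text \<open>
  Polynomials in variables indexed by \<open>'x\<close> are finitely supported functions from monomials
  \<open>'x \<Rightarrow>\<^sub>0 nat\<close> to coefficients, here over \<open>F(z) = 'a poly fract\<close>. With \<open>'x\<close> the index type
  of the indeterminates \<open>K\<close>, their field of fractions is \<open>F(z,K)\<close>.
\<close>

type_synonym ('x, 'a) gain_field = "(('x \<Rightarrow>\<^sub>0 nat) \<Rightarrow>\<^sub>0 'a poly fract) fract"

definition const_gf :: "'a::field poly fract \<Rightarrow> ('x::linorder, 'a) gain_field" where
  "const_gf q = to_fract (Poly_Mapping.single 0 q)"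

definition indet_gf :: "'x::linorder \<Rightarrow> ('x, 'a::field) gain_field" where
  "indet_gf x = to_fract (Poly_Mapping.single (Poly_Mapping.single x 1) 1)"

definition mat_rank :: "'k::field mat \<Rightarrow> nat" where
  "mat_rank A = vec_space.rank (dim_row A) A"

text \<open>
  Block rows and columns. The size argument is the common number of rows (resp.\ columns),
  needed when the list of blocks is empty.
\<close>

definition append_cols :: "'k::zero mat \<Rightarrow> 'k mat \<Rightarrow> 'k mat" where
  "append_cols A B = four_block_mat A B (0\<^sub>m 0 (dim_col A)) (0\<^sub>m 0 (dim_col B))"

definition hcat :: "nat \<Rightarrow> 'k::zero mat list \<Rightarrow> 'k mat" where
  "hcat nr As = foldr append_cols As (0\<^sub>m nr 0)"

definition vcat :: "nat \<Rightarrow> 'k::zero mat list \<Rightarrow> 'k mat" where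
  "vcat nc As = foldr append_rows As (0\<^sub>m 0 nc)"

text \<open>
  The relays are \<open>Relay 1, \<dots>, Relay v\<close>; \<open>channel N i j\<close> is the matrix \<open>H\<^sub>i\<^sub>,\<^sub>j\<close> from node \<open>i\<close> to
  node \<open>j\<close>. Values of the fields at other nodes (for instance \<open>inputs N Rx\<close>) carry no meaning.
\<close>

datatype node = Tx | Rx | Relay nat

record (overloaded) ('a::field) lti_network =
  num_relays :: nat
  inputs :: "node \<Rightarrow> nat"
  outputs :: "node \<Rightarrow> nat"
  channel :: "node \<Rightarrow> node \<Rightarrow> 'a poly fract mat"

definition relay_list :: "('a::field) lti_network \<Rightarrow> nat list" where
  "relay_list N = [1..<Suc (num_relays N)]"

definition is_lti_network :: "('a::field) lti_network \<Rightarrow> bool" where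
  "is_lti_network N \<longleftrightarrow>
     (\<forall>i \<in> insert Tx (Relay ` {1..num_relays N}). \<forall>j \<in> insert Rx (Relay ` {1..num_relays N}).
        channel N i j \<in> carrier_mat (outputs N j) (inputs N i))"

text \<open>Names of the entries of the gain matrices; row and column indices start at \<open>0\<close>.\<close>

datatype gain_entry = Tx_Entry nat nat | Rx_Entry nat nat | Relay_Entry nat nat nat

definition gain_entries :: "('a::field) lti_network \<Rightarrow> nat \<Rightarrow> gain_entry set" where
  "gain_entries N d_ax =
     {Tx_Entry a b | a b. a < inputs N Tx \<and> b < d_ax} \<union>
     {Rx_Entry a b | a b. a < d_ax \<and> b < outputs N Rx} \<union>
     {Relay_Entry i a b | i a b.
        i \<in> {1..num_relays N} \<and> a < inputs N (Relay i) \<and> b < outputs N (Relay i)}"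

text \<open>
  In the following, \<open>X\<close> assigns to each entry the index of the indeterminate placed there.
\<close>

definition K_tx :: "(gain_entry \<Rightarrow> 'x::linorder) \<Rightarrow> ('a::field) lti_network \<Rightarrow> nat
    \<Rightarrow> ('x, 'a) gain_field mat" where
  "K_tx X N d_ax = mat (inputs N Tx) d_ax (\<lambda>(a, b). indet_gf (X (Tx_Entry a b)))"

definition K_rx :: "(gain_entry \<Rightarrow> 'x::linorder) \<Rightarrow> ('a::field) lti_network \<Rightarrow> nat
    \<Rightarrow> ('x, 'a) gain_field mat" where
  "K_rx X N d_ax = mat d_ax (outputs N Rx) (\<lambda>(a, b). indet_gf (X (Rx_Entry a b)))"

definition K_relay :: "(gain_entry \<Rightarrow> 'x::linorder) \<Rightarrow> ('a::field) lti_network \<Rightarrow> nat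
    \<Rightarrow> ('x, 'a) gain_field mat" where
  "K_relay X N i =
     mat (inputs N (Relay i)) (outputs N (Relay i)) (\<lambda>(a, b). indet_gf (X (Relay_Entry i a b)))"

definition chan :: "('a::field) lti_network \<Rightarrow> node \<Rightarrow> node \<Rightarrow> ('x::linorder, 'a) gain_field mat" where
  "chan N i j = map_mat const_gf (channel N i j)"

definition relay_outputs :: "('a::field) lti_network \<Rightarrow> nat" where
  "relay_outputs N = (\<Sum>i = 1..num_relays N. outputs N (Relay i))"

definition relay_loop :: "(gain_entry \<Rightarrow> 'x::linorder) \<Rightarrow> ('a::field) lti_network
    \<Rightarrow> ('x, 'a) gain_field mat" where
  "relay_loop X N =
     vcat (relay_outputs N)
       [hcat (outputs N (Relay j)) [chan N (Relay i) (Relay j) * K_relay X N i. i \<leftarrow> relay_list N].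
        j \<leftarrow> relay_list N]"

definition transfer_matrix :: "(gain_entry \<Rightarrow> 'x::linorder) \<Rightarrow> ('a::field) lti_network
    \<Rightarrow> ('x, 'a) gain_field mat" where
  "transfer_matrix X N =
     chan N Tx Rx +
     hcat (outputs N Rx) [chan N (Relay i) Rx * K_relay X N i. i \<leftarrow> relay_list N] *
     the (mat_inverse (1\<^sub>m (relay_outputs N) - relay_loop X N)) *
     vcat (inputs N Tx) [chan N Tx (Relay j). j \<leftarrow> relay_list N]"

definition G_lin :: "(gain_entry \<Rightarrow> 'x::linorder) \<Rightarrow> ('a::field) lti_network \<Rightarrow> nat
    \<Rightarrow> ('x, 'a) gain_field mat" where
  "G_lin X N d_ax =
     vcat (d_ax + outputs N Rx + relay_outputs N)
       ([hcat d_ax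
           ([0\<^sub>m d_ax d_ax, - K_rx X N d_ax] @
            [0\<^sub>m d_ax (outputs N (Relay i)). i \<leftarrow> relay_list N]),
         hcat (outputs N Rx)
           ([- (chan N Tx Rx * K_tx X N d_ax), 1\<^sub>m (outputs N Rx)] @
            [- (chan N (Relay i) Rx * K_relay X N i). i \<leftarrow> relay_list N])] @
        [hcat (outputs N (Relay j))
           ([- (chan N Tx (Relay j) * K_tx X N d_ax), 0\<^sub>m (outputs N (Relay j)) (outputs N Rx)] @
            [if i = j then 1\<^sub>m (outputs N (Relay j)) - chan N (Relay j) (Relay j) * K_relay X N j
             else - (chan N (Relay i) (Relay j) * K_relay X N i).
             i \<leftarrow> relay_list N]).
         j \<leftarrow> relay_list N])"

end

theory Submission
  imports Defs "Jordan_Normal_Form.Matrix_Kernel"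
begin

text \<open>
  The relay loop matrix \<open>L\<close> has entries in \<open>F(z)[K]\<close> without constant term, so \<open>det (I - L)\<close> specialises
  to \<open>1\<close> at \<open>K = 0\<close> and \<open>I - L\<close> is invertible over \<open>F(z,K)\<close>. With \<open>R\<close> the row of the blocks
  \<open>H\<^sub>i\<^sub>,\<^sub>r\<^sub>x K\<^sub>i\<close>, the lower right block \<open>[I, -R; 0, I - L]\<close> of \<open>G\<^sub>l\<^sub>i\<^sub>n\<close> is therefore invertible of size
  \<open>d\<close>, and its Schur complement is \<open>- K\<^sub>r\<^sub>x G K\<^sub>t\<^sub>x\<close>. Block elimination does not change the rank.
\<close>

section \<open>Rank, kernel dimension and Schur complements\<close>

text \<open>Rank-nullity for multiplication by \<open>A\<close>, whose image is the span of the
  columns. Rank identities can then be proved by comparing kernel dimensions.\<close>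

lemma mat_rank_plus_kernel_dim:
  fixes A :: "'k::field mat"
  assumes A: "A \<in> carrier_mat nr nc"
  shows "mat_rank A + kernel.dim nc A = nc"
proof -
  interpret R: vec_space "TYPE('k)" nr .
  interpret C: vec_space "TYPE('k)" nc .
  interpret T: linear_map class_ring "module_vec TYPE('k) nc" "module_vec TYPE('k) nr" "(*\<^sub>v) A"
  proof unfold_locales
    show "(*\<^sub>v) A \<in> LinearCombinations.module_hom class_ring (module_vec TYPE('k) nc) (module_vec TYPE('k) nr)"
      using A by (auto simp: LinearCombinations.module_hom_def module_vec_simps class_ring_simps
          mult_add_distrib_mat_vec[OF A] mult_mat_vec[OF A])
  qed
  have "T.im = R.span (set (cols A))"
    using R.col_space_eq[OF A] A
    by (auto simp: T.im_def R.col_space_def module_vec_simps image_def)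
  moreover have "T.ker = mat_kernel A"
    using A by (auto simp: T.ker_def mat_kernel_def module_vec_simps)
  ultimately show ?thesis
    using T.rank_nullity[OF C.fin_dim] A C.dim_is_n
    by (simp add: mat_rank_def R.rank_def)
qed

lemma kernel_dim_mult_invertible_left:
  fixes A :: "'k::field mat"
  assumes "A \<in> carrier_mat nr nc" "P \<in> carrier_mat nr nr" "Q \<in> carrier_mat nr nr" "Q * P = 1\<^sub>m nr"
  shows "kernel.dim nc (P * A) = kernel.dim nc A"
  using mat_kernel_mult_eq[OF assms] by simp

lemma uminus_zero_mat: "- (0\<^sub>m n m :: 'k::group_add mat) = 0\<^sub>m n m"
  by (rule eq_matI) auto

lemma mat_add_uminus:
  assumes "A \<in> carrier_mat n m"
  shows "A + - A = (0\<^sub>m n m :: 'k::ab_group_add mat)" and "- A + A = 0\<^sub>m n m"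
  using assms by auto

text \<open>Both matrices kill the same vectors, so rank-nullity applies to equal kernels. The sign
  matters because the Schur complement in \<open>G_lin\<close> comes out negated.\<close>

lemma mat_rank_uminus: "mat_rank (- A) = mat_rank (A :: 'k::field mat)"
proof -
  have A: "A \<in> carrier_mat (dim_row A) (dim_col A)" by simp
  have "mat_kernel (- A) = mat_kernel A"
    by (auto simp: mat_kernel_def uminus_zero_vec_eq[OF mult_mat_vec_carrier[OF A]])
  then show ?thesis
    using mat_rank_plus_kernel_dim[OF A] mat_rank_plus_kernel_dim[of "- A" "dim_row A" "dim_col A"]
    by simp
qed

text \<open>With \<open>S = A - B * E * C\<close>, the block matrix factors as the upper
  unitriangular matrix with corner \<open>B * E\<close>, times the block diagonal matrix of
  \<open>S\<close> and \<open>D\<close>, times the lower unitriangular matrix with corner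
  \<open>E * C\<close>. The outer factors are invertible and \<open>D\<close> has full rank
  \<open>m\<close>.\<close>

lemma mat_rank_schur_complement:
  fixes A B C D E :: "'k::field mat"
  assumes A: "A \<in> carrier_mat n n" and B: "B \<in> carrier_mat n m"
    and C: "C \<in> carrier_mat m n" and D: "D \<in> carrier_mat m m" and E: "E \<in> carrier_mat m m"
    and DE: "D * E = 1\<^sub>m m" and ED: "E * D = 1\<^sub>m m"
  shows "mat_rank (four_block_mat A B C D) = mat_rank (A - B * E * C) + m"
proof -
  let ?S = "A - B * E * C"
  let ?U = "\<lambda>X. four_block_mat (1\<^sub>m n) X (0\<^sub>m m n) (1\<^sub>m m)"
  let ?L = "\<lambda>X. four_block_mat (1\<^sub>m n) (0\<^sub>m n m) X (1\<^sub>m m)"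
  let ?M = "four_block_mat ?S (0\<^sub>m n m) (0\<^sub>m m n) D"
  note mult = mult_four_block_mat[where ?nr1.0 = n and ?nr2.0 = m and ?n1.0 = n and ?n2.0 = m
      and ?nc1.0 = n and ?nc2.0 = m]
  have S: "?S \<in> carrier_mat n n" using A B C E by auto
  have BE: "B * E \<in> carrier_mat n m" and EC: "E * C \<in> carrier_mat m n" using B C E by auto
  have cu: "?U X \<in> carrier_mat (n+m) (n+m)" for X :: "'k mat" by auto
  have cl: "?L X \<in> carrier_mat (n+m) (n+m)" for X :: "'k mat" by auto
  have u: "- X * 0\<^sub>m k j = 0\<^sub>m l j" "0\<^sub>m j l * - X = 0\<^sub>m j k" "- X * 1\<^sub>m k = - X" "1\<^sub>m l * - X = - X"
      "X * 0\<^sub>m k j = 0\<^sub>m l j" "0\<^sub>m j l * X = 0\<^sub>m j k" "X * 1\<^sub>m k = X" "1\<^sub>m l * X = X"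
    if "X \<in> carrier_mat l k" for X :: "'k mat" and j k l
    using that uminus_zero_mat by (simp_all add: right_mult_zero_mat[of _ l k] left_mult_zero_mat[of _ l k]
        right_mult_one_mat[of _ l k] left_mult_one_mat[of _ l k])
  \<comment> \<open>Unitriangular block matrices are inverted by negating the corner. In
    \<open>U\<close> the inverse stands on the left and in \<open>L\<close> on the right, the sides
    from which the factors are cancelled below.\<close>
  have U: "?U (-(B*E)) * ?U (B*E) = 1\<^sub>m (n+m)"
    using BE mat_add_uminus[OF BE] u[OF BE] by (subst mult) auto
  have L: "?L (E*C) * ?L (-(E*C)) = 1\<^sub>m (n+m)"
    using EC mat_add_uminus[OF EC] u[OF EC] by (subst mult) auto
  have M: "?M \<in> carrier_mat (n+m) (n+m)" using A D B C E by auto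
  \<comment> \<open>The lower left block is \<open>D * (E * C)\<close>, which collapses to
    \<open>C\<close> because \<open>E\<close> inverts \<open>D\<close>.\<close>
  have MX: "?M * ?L (E*C) = four_block_mat ?S (0\<^sub>m n m) C D"
  proof -
    have "D * (E * C) = C" using assoc_mult_mat[OF D E C] DE left_mult_one_mat[OF C] by simp
    then show ?thesis using S C D EC left_mult_zero_mat[OF EC, of n] right_mult_one_mat[OF D]
        right_mult_one_mat[OF S] right_mult_zero_mat[OF S] left_add_zero_mat[OF C] left_add_zero_mat[OF D]
      by (subst mult[OF S zero_carrier_mat zero_carrier_mat D one_carrier_mat zero_carrier_mat EC one_carrier_mat])
        (simp add: comm_add_mat)
  qed
  \<comment> \<open>The upper row becomes \<open>?S + B * E * C\<close>, restoring \<open>A\<close>,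
    and \<open>B * E * D\<close>, restoring \<open>B\<close>.\<close>
  have UMX: "?U (B*E) * four_block_mat ?S (0\<^sub>m n m) C D = four_block_mat A B C D"
  proof -
    have "B * E * D = B" using assoc_mult_mat[OF B E D] ED right_mult_one_mat[OF B] by simp
    moreover have "?S + B * E * C = A" using A B C E by (intro eq_matI) auto
    ultimately show ?thesis
      using left_mult_one_mat[OF S] left_add_zero_mat[OF B] left_mult_one_mat[OF C] left_mult_one_mat[OF D]
        left_mult_zero_mat[OF S, of m] left_add_zero_mat[OF C] left_add_zero_mat[OF D]
      by (subst mult[OF one_carrier_mat BE zero_carrier_mat one_carrier_mat S zero_carrier_mat C D]) simp
  qed
  have "kernel.dim (n+m) (four_block_mat A B C D) = kernel.dim (n+m) (?M * ?L (E*C))"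
    unfolding UMX[symmetric] MX[symmetric]
    by (rule kernel_dim_mult_invertible_left[OF mult_carrier_mat[OF M cl] cu cu U])
  also have "\<dots> = kernel.dim (n+m) ?M"
    by (rule mat_kernel_dim_mult_eq_right[OF M cl cl L])
  also have "\<dots> = kernel.dim n ?S + kernel.dim m D"
    by (rule kernel_four_block_0_mat[OF refl S D])
  \<comment> \<open>\<open>D\<close> is read as \<open>D * 1\<^sub>m m\<close> with left inverse
    \<open>E\<close>, so its kernel is that of the identity.\<close>
  also have "kernel.dim m D = 0"
    using kernel_dim_mult_invertible_left[OF one_carrier_mat D E ED] kernel_one_mat(1)[of m] D
    by simp
  finally have "kernel.dim (n+m) (four_block_mat A B C D) = kernel.dim n ?S" by simp
  moreover have "four_block_mat A B C D \<in> carrier_mat (n+m) (n+m)" using A D by simp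
  ultimately show ?thesis
    using mat_rank_plus_kernel_dim[of "four_block_mat A B C D" "n+m" "n+m"]
      mat_rank_plus_kernel_dim[OF S] by simp
qed

section \<open>Arithmetic of block rows and block columns\<close>

lemma append_cols_carrier [simp]:
  "A \<in> carrier_mat n k \<Longrightarrow> B \<in> carrier_mat n l \<Longrightarrow> append_cols A B \<in> carrier_mat n (k + l)"
  by (auto simp: append_cols_def)

lemma hcat_Nil [simp]: "hcat n [] = 0\<^sub>m n 0"
  and hcat_Cons [simp]: "hcat n (A # As) = append_cols A (hcat n As)"
  by (simp_all add: hcat_def)

lemma vcat_Nil [simp]: "vcat n [] = 0\<^sub>m 0 n"
  and vcat_Cons [simp]: "vcat n (A # As) = A @\<^sub>r vcat n As"
  by (simp_all add: vcat_def)

text \<open>This and the next lemma bring rows of columns and columns of rows to the same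
  \<open>four_block_mat\<close>. Together they give the interchange law by which blocks are
  regrouped.\<close>

lemma append_rows_append_cols:
  assumes "A \<in> carrier_mat n k" "B \<in> carrier_mat n l" "C \<in> carrier_mat m k" "D \<in> carrier_mat m l"
  shows "append_cols A B @\<^sub>r append_cols C D = four_block_mat A B C D"
  using assms by (intro eq_matI) (auto simp: append_rows_def append_cols_def)

lemma append_cols_append_rows:
  assumes "A \<in> carrier_mat n k" "B \<in> carrier_mat n l" "C \<in> carrier_mat m k" "D \<in> carrier_mat m l"
  shows "append_cols (A @\<^sub>r C) (B @\<^sub>r D) = four_block_mat A B C D"
  using assms by (intro eq_matI) (auto simp: append_rows_def append_cols_def)

text \<open>Row \<open>i\<close> of a product depends only on row \<open>i\<close> of the left
  factor.\<close>

lemma append_rows_mult: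
  fixes A B K :: "'k::semiring_0 mat"
  assumes "A \<in> carrier_mat n k" "B \<in> carrier_mat m k" "K \<in> carrier_mat k l"
  shows "(A * K) @\<^sub>r (B * K) = (A @\<^sub>r B) * K"
proof (rule eq_matI)
  fix i j assume ij: "i < dim_row ((A @\<^sub>r B) * K)" "j < dim_col ((A @\<^sub>r B) * K)"
  have "row (A @\<^sub>r B) i = (if i < n then row A i else row B (i - n))"
    using assms ij by (intro eq_vecI) (auto simp: append_rows_def)
  then show "((A * K) @\<^sub>r (B * K)) $$ (i, j) = ((A @\<^sub>r B) * K) $$ (i, j)"
    using assms ij by (auto simp: append_rows_def)
qed (use assms in \<open>auto simp: append_rows_def\<close>)

text \<open>Block widths are a function \<open>c\<close> of the index, since relays may differ in
  their numbers of outputs.\<close>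

lemma hcat_map_carrier:
  assumes "\<And>i. i \<in> set is \<Longrightarrow> f i \<in> carrier_mat n (c i)"
  shows "hcat n (map f is) \<in> carrier_mat n (\<Sum>i\<leftarrow>is. c i)"
  using assms by (induction "is") auto

lemma vcat_map_carrier:
  assumes "\<And>j. j \<in> set js \<Longrightarrow> f j \<in> carrier_mat (c j) n"
  shows "vcat n (map f js) \<in> carrier_mat (\<Sum>j\<leftarrow>js. c j) n"
  using assms by (induction js) auto

lemma hcat_map_zero: "hcat n (map (\<lambda>i. 0\<^sub>m n (c i)) is) = 0\<^sub>m n (\<Sum>i\<leftarrow>is. c i)"
  by (induction "is") (auto simp: append_cols_def)

lemma vcat_map_zero: "vcat n (map (\<lambda>j. 0\<^sub>m (c j) n) js) = 0\<^sub>m (\<Sum>j\<leftarrow>js. c j) n"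
  by (induction js) (auto simp: append_rows_def)

lemma append_cols_minus:
  fixes A B C D :: "'k::group_add mat"
  assumes "A \<in> carrier_mat n k" "B \<in> carrier_mat n l" "C \<in> carrier_mat n k" "D \<in> carrier_mat n l"
  shows "append_cols (A - C) (B - D) = (append_cols A B) - (append_cols C D)"
  using assms by (intro eq_matI) (auto simp: append_cols_def)

lemma append_cols_uminus:
  fixes A B :: "'k::group_add mat"
  assumes "A \<in> carrier_mat n k" "B \<in> carrier_mat n l"
  shows "append_cols (- A) (- B) = - (append_cols A B)"
  using assms by (intro eq_matI) (auto simp: append_cols_def)

lemma hcat_map_minus:
  fixes f g :: "'i \<Rightarrow> 'k::group_add mat"
  assumes "\<And>i. i \<in> set is \<Longrightarrow> f i \<in> carrier_mat n (c i)"
    and "\<And>i. i \<in> set is \<Longrightarrow> g i \<in> carrier_mat n (c i)"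
  shows "hcat n (map (\<lambda>i. f i - g i) is) = hcat n (map f is) - hcat n (map g is)"
  using assms
proof (induction "is")
  case (Cons a "is")
  have F: "hcat n (map f is) \<in> carrier_mat n (\<Sum>i\<leftarrow>is. c i)" and G: "hcat n (map g is) \<in> carrier_mat n (\<Sum>i\<leftarrow>is. c i)"
    using Cons.prems by (auto intro!: hcat_map_carrier)
  have f: "f a \<in> carrier_mat n (c a)" and g: "g a \<in> carrier_mat n (c a)"
    using Cons.prems by auto
  show ?case
    using Cons by (simp add: append_cols_minus[OF f F g G])
qed (auto intro!: eq_matI)

lemma append_rows_minus:
  fixes A B C D :: "'k::group_add mat"
  assumes "A \<in> carrier_mat n k" "B \<in> carrier_mat m k" "C \<in> carrier_mat n k" "D \<in> carrier_mat m k"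
  shows "(A - C) @\<^sub>r (B - D) = (A @\<^sub>r B) - (C @\<^sub>r D)"
  using assms by (intro eq_matI) (auto simp: append_rows_def)

lemma append_rows_uminus:
  fixes A B :: "'k::group_add mat"
  assumes "A \<in> carrier_mat n k" "B \<in> carrier_mat m k"
  shows "(- A) @\<^sub>r (- B) = - (A @\<^sub>r B)"
  using assms by (intro eq_matI) (auto simp: append_rows_def)

lemma vcat_map_minus:
  fixes f g :: "'i \<Rightarrow> 'k::group_add mat"
  assumes "\<And>j. j \<in> set js \<Longrightarrow> f j \<in> carrier_mat (c j) n"
    and "\<And>j. j \<in> set js \<Longrightarrow> g j \<in> carrier_mat (c j) n"
  shows "vcat n (map (\<lambda>j. f j - g j) js) = vcat n (map f js) - vcat n (map g js)"
  using assms
proof (induction js)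
  case (Cons a js)
  have F: "vcat n (map f js) \<in> carrier_mat (\<Sum>j\<leftarrow>js. c j) n" and G: "vcat n (map g js) \<in> carrier_mat (\<Sum>j\<leftarrow>js. c j) n"
    using Cons.prems by (auto intro!: vcat_map_carrier)
  have f: "f a \<in> carrier_mat (c a) n" and g: "g a \<in> carrier_mat (c a) n"
    using Cons.prems by auto
  show ?case
    using Cons by (simp add: append_rows_minus[OF f F g G])
qed (auto intro!: eq_matI)

lemma hcat_map_uminus:
  fixes f :: "'i \<Rightarrow> 'k::group_add mat"
  assumes "\<And>i. i \<in> set is \<Longrightarrow> f i \<in> carrier_mat n (c i)"
  shows "hcat n (map (\<lambda>i. - f i) is) = - hcat n (map f is)"
  using assms
proof (induction "is")
  case (Cons a "is")
  have F: "hcat n (map f is) \<in> carrier_mat n (\<Sum>i\<leftarrow>is. c i)"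
    using Cons.prems by (auto intro!: hcat_map_carrier)
  have f: "f a \<in> carrier_mat n (c a)"
    using Cons.prems by auto
  show ?case
    using Cons by (simp add: append_cols_uminus[OF f F])
qed (auto intro!: eq_matI)

lemma vcat_map_uminus:
  fixes f :: "'i \<Rightarrow> 'k::group_add mat"
  assumes "\<And>j. j \<in> set js \<Longrightarrow> f j \<in> carrier_mat (c j) n"
  shows "vcat n (map (\<lambda>j. - f j) js) = - vcat n (map f js)"
  using assms
proof (induction js)
  case (Cons a js)
  have F: "vcat n (map f js) \<in> carrier_mat (\<Sum>j\<leftarrow>js. c j) n"
    using Cons.prems by (auto intro!: vcat_map_carrier)
  have f: "f a \<in> carrier_mat (c a) n"
    using Cons.prems by auto
  show ?case
    using Cons by (simp add: append_rows_uminus[OF f F])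
qed (auto intro!: eq_matI)

lemma vcat_map_mult:
  fixes f :: "'i \<Rightarrow> 'k::semiring_0 mat"
  assumes "\<And>j. j \<in> set js \<Longrightarrow> f j \<in> carrier_mat (c j) k" and K: "K \<in> carrier_mat k l"
  shows "vcat l (map (\<lambda>j. f j * K) js) = vcat k (map f js) * K"
  using assms(1)
proof (induction js)
  case Nil
  show ?case using K by (auto intro!: eq_matI)
next
  case (Cons a js)
  have F: "vcat k (map f js) \<in> carrier_mat (\<Sum>j\<leftarrow>js. c j) k"
    using Cons.prems by (intro vcat_map_carrier) auto
  have f: "f a \<in> carrier_mat (c a) k"
    using Cons.prems by auto
  show ?case
    using Cons by (simp add: append_rows_mult[OF f F K])
qed

text \<open>The interchange law for a whole list of block rows, obtained from one 2 x 2 interchange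
  per row. It splits off the leading block column.\<close>

lemma vcat_map_append_cols:
  assumes "\<And>j. j \<in> set js \<Longrightarrow> f j \<in> carrier_mat (c j) k"
    and "\<And>j. j \<in> set js \<Longrightarrow> g j \<in> carrier_mat (c j) l"
  shows "vcat (k + l) (map (\<lambda>j. append_cols (f j) (g j)) js)
    = append_cols (vcat k (map f js)) (vcat l (map g js))"
  using assms
proof (induction js)
  case Nil
  show ?case by (auto intro!: eq_matI simp: append_cols_def)
next
  case (Cons a js)
  have F: "vcat k (map f js) \<in> carrier_mat (\<Sum>j\<leftarrow>js. c j) k"
    using Cons.prems by (intro vcat_map_carrier) auto
  have G: "vcat l (map g js) \<in> carrier_mat (\<Sum>j\<leftarrow>js. c j) l"
    using Cons.prems by (intro vcat_map_carrier) auto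
  have f: "f a \<in> carrier_mat (c a) k" and g: "g a \<in> carrier_mat (c a) l"
    using Cons.prems by auto
  show ?case
    using Cons append_rows_append_cols[OF f g F G] append_cols_append_rows[OF f g F G] by simp
qed

text \<open>Removing the first index leaves a 2 x 2 block matrix with identities on the diagonal;
  distinctness makes the other two blocks vanish.\<close>

lemma vcat_hcat_one:
  fixes c :: "'i \<Rightarrow> nat"
  assumes "distinct is"
  shows "vcat (\<Sum>i\<leftarrow>is. c i)
      (map (\<lambda>j. hcat (c j) (map (\<lambda>i. if i = j then 1\<^sub>m (c j) else 0\<^sub>m (c j) (c i)) is)) is)
    = (1\<^sub>m (\<Sum>i\<leftarrow>is. c i) :: 'k::zero_neq_one mat)"
  using assms
proof (induction "is")
  case (Cons a "is")
  let ?\<delta> = "\<lambda>i j. if i = j then 1\<^sub>m (c j) else 0\<^sub>m (c j) (c i) :: 'k mat"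
  let ?s = "\<Sum>i\<leftarrow>is. c i"
  let ?h = "\<lambda>j. hcat (c j) (map (\<lambda>i. ?\<delta> i j) is)"
  have h: "?h j \<in> carrier_mat (c j) ?s" for j
    by (rule hcat_map_carrier) auto
  have "vcat (c a + ?s) (map (\<lambda>j. append_cols (?\<delta> a j) (?h j)) is)
      = append_cols (vcat (c a) (map (\<lambda>j. ?\<delta> a j) is)) (vcat ?s (map ?h is))"
    by (rule vcat_map_append_cols[where c = c]) (use h in auto)
  \<comment> \<open>Distinctness puts \<open>a\<close> outside \<open>is\<close>, so only the zero
    branch of the conditional occurs.\<close>
  also have "map (\<lambda>j. ?\<delta> a j) is = map (\<lambda>j. 0\<^sub>m (c j) (c a)) is"
    using Cons.prems by auto
  also have "vcat ?s (map ?h is) = 1\<^sub>m ?s"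
    using Cons by simp
  finally have lower: "vcat (c a + ?s) (map (\<lambda>j. append_cols (?\<delta> a j) (?h j)) is)
      = append_cols (0\<^sub>m ?s (c a)) (1\<^sub>m ?s)"
    by (simp only: vcat_map_zero)
  have "map (\<lambda>i. ?\<delta> i a) is = map (\<lambda>i. 0\<^sub>m (c a) (c i)) is"
    using Cons.prems by auto
  then have "?h a = 0\<^sub>m (c a) ?s"
    by (simp only: hcat_map_zero)
  then show ?case
    using lower append_rows_append_cols[OF one_carrier_mat zero_carrier_mat zero_carrier_mat one_carrier_mat, of "c a" ?s]
    by (simp add: four_block_one_mat)
qed (auto intro!: eq_matI)

text \<open>The conditional is the one in \<open>G_lin\<close>. Each block is an identity or zero
  block minus \<open>A i j\<close>, and the difference moves out through \<open>hcat\<close> and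
  then \<open>vcat\<close>.\<close>

lemma vcat_hcat_one_minus:
  fixes A :: "'i \<Rightarrow> 'i \<Rightarrow> 'k::ring_1 mat"
  assumes "distinct is"
    and A: "\<And>i j. i \<in> set is \<Longrightarrow> j \<in> set is \<Longrightarrow> A i j \<in> carrier_mat (c j) (c i)"
  shows "vcat (\<Sum>i\<leftarrow>is. c i)
      (map (\<lambda>j. hcat (c j) (map (\<lambda>i. if i = j then 1\<^sub>m (c j) - A j j else - A i j) is)) is)
    = 1\<^sub>m (\<Sum>i\<leftarrow>is. c i) - vcat (\<Sum>i\<leftarrow>is. c i) (map (\<lambda>j. hcat (c j) (map (\<lambda>i. A i j) is)) is)"
proof -
  let ?\<delta> = "\<lambda>i j. if i = j then 1\<^sub>m (c j) else 0\<^sub>m (c j) (c i) :: 'k mat"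
  have "(if i = j then 1\<^sub>m (c j) - A j j else - A i j) = ?\<delta> i j - A i j"
    if "i \<in> set is" "j \<in> set is" for i j
    using A[OF that] by (auto intro!: eq_matI)
  then have "map (\<lambda>j. hcat (c j) (map (\<lambda>i. if i = j then 1\<^sub>m (c j) - A j j else - A i j) is)) is
      = map (\<lambda>j. hcat (c j) (map (\<lambda>i. ?\<delta> i j - A i j) is)) is"
    by (intro map_cong refl arg_cong[of _ _ "hcat _"]) auto
  also have "\<dots> = map (\<lambda>j. hcat (c j) (map (\<lambda>i. ?\<delta> i j) is) - hcat (c j) (map (\<lambda>i. A i j) is)) is"
    by (intro map_cong refl hcat_map_minus[where c = c]) (use A in auto)
  also have "vcat (\<Sum>i\<leftarrow>is. c i) \<dots> = vcat (\<Sum>i\<leftarrow>is. c i) (map (\<lambda>j. hcat (c j) (map (\<lambda>i. ?\<delta> i j) is)) is)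
      - vcat (\<Sum>i\<leftarrow>is. c i) (map (\<lambda>j. hcat (c j) (map (\<lambda>i. A i j) is)) is)"
    by (intro vcat_map_minus[where c = c] hcat_map_carrier) (use A in auto)
  finally show ?thesis
    by (simp only: vcat_hcat_one[OF assms(1)])
qed

section \<open>Constant terms and invertibility of the identity minus the loop matrix\<close>

text \<open>This is evaluation at \<open>K = 0\<close>. It is multiplicative because exponents are
  natural numbers, so two exponent vectors sum to zero only if both are zero.\<close>

lemma comm_ring_hom_lookup_0:
  "comm_ring_hom (\<lambda>p :: ('x \<Rightarrow>\<^sub>0 nat) \<Rightarrow>\<^sub>0 'c::comm_ring_1. poly_mapping.lookup p 0)"
proof
  fix p q :: "('x \<Rightarrow>\<^sub>0 nat) \<Rightarrow>\<^sub>0 'c"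
  show "poly_mapping.lookup (p + q) 0 = poly_mapping.lookup p 0 + poly_mapping.lookup q 0"
    by (rule lookup_add)
  have "0 = l + m \<longleftrightarrow> l = 0 \<and> m = 0" for l m :: "'x \<Rightarrow>\<^sub>0 nat"
    by (auto simp: poly_mapping_eq_iff fun_eq_iff lookup_add)
  \<comment> \<open>In the convolution sum for the coefficient at \<open>0\<close>, only the pair
    \<open>l = m = 0\<close> survives.\<close>
  then have "poly_mapping.lookup (p * q) 0
      = (\<Sum>l. poly_mapping.lookup p l * (\<Sum>m. (poly_mapping.lookup q m when m = 0) when l = 0))"
    by (simp add: lookup_mult when_when conj_commute)
  also have "\<dots> = (\<Sum>l. poly_mapping.lookup p l * poly_mapping.lookup q 0 when l = 0)"
    by (simp add: Sum_any_when_independent mult_when)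
  finally show "poly_mapping.lookup (p * q) 0 = poly_mapping.lookup p 0 * poly_mapping.lookup q 0"
    by simp
qed (simp_all add: lookup_one)

text \<open>The ideal of polynomials vanishing at \<open>K = 0\<close>, embedded in the field of
  fractions. Members come from polynomials rather than general fractions, so evaluation at 0 needs
  no care about denominators.\<close>

definition zero_const_fracts :: "(('x::linorder \<Rightarrow>\<^sub>0 nat) \<Rightarrow>\<^sub>0 'c::idom) fract set" where
  "zero_const_fracts = to_fract ` {p. poly_mapping.lookup p 0 = 0}"

lemma zero_const_fracts_0: "0 \<in> zero_const_fracts"
  unfolding zero_const_fracts_def by (rule image_eqI[of _ _ 0]) simp_all

lemma zero_const_fracts_sum:
  assumes "\<And>i. i \<in> I \<Longrightarrow> f i \<in> zero_const_fracts"
  shows "sum f I \<in> zero_const_fracts"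
  using assms
proof (induction I rule: infinite_finite_induct)
  case (insert i I)
  then obtain p q where "f i = to_fract p" "poly_mapping.lookup p 0 = 0"
      "sum f I = to_fract q" "poly_mapping.lookup q 0 = 0"
    unfolding zero_const_fracts_def by fast
  then show ?case
    using insert.hyps unfolding zero_const_fracts_def
    by (intro image_eqI[of _ _ "p + q"]) (simp_all add: lookup_add)
qed (simp_all add: zero_const_fracts_0)

text \<open>The product is a single term with monomial \<open>x\<close>, whose exponent vector is
  not zero.\<close>

lemma const_mult_indet_in_zero_const_fracts:
  fixes x :: "'x::linorder" and c :: "'c::field poly fract"
  shows "const_gf c * indet_gf x \<in> zero_const_fracts"
proof -
  have "Poly_Mapping.single x 1 \<noteq> (0 :: 'x \<Rightarrow>\<^sub>0 nat)"
    by (metis lookup_single_eq lookup_zero zero_neq_one)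
  then show ?thesis
    unfolding const_gf_def indet_gf_def zero_const_fracts_def
    by (intro image_eqI[of _ _ "Poly_Mapping.single 0 c * Poly_Mapping.single (Poly_Mapping.single x 1) 1"])
      (simp_all add: mult_single lookup_single_not_eq flip: to_fract_mult)
qed

text \<open>The matrix lifts to a polynomial matrix \<open>P\<close>, and determinants commute with
  ring homomorphisms. Evaluation at 0 sends \<open>det P\<close> to the determinant of the identity,
  and injectivity of \<open>to_fract\<close> carries \<open>det P \<noteq> 0\<close> to the field of
  fractions.\<close>

lemma det_one_minus_nonzero:
  assumes L: "L \<in> carrier_mat n n" and S: "elements_mat L \<subseteq> zero_const_fracts"
  shows "det (1\<^sub>m n - L) \<noteq> 0"
proof -
  interpret \<phi>: comm_ring_hom "\<lambda>p :: ('a \<Rightarrow>\<^sub>0 nat) \<Rightarrow>\<^sub>0 'b. poly_mapping.lookup p 0"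
    by (rule comm_ring_hom_lookup_0)
  interpret \<iota>: inj_comm_ring_hom "to_fract :: (('a \<Rightarrow>\<^sub>0 nat) \<Rightarrow>\<^sub>0 'b) \<Rightarrow> _"
    by unfold_locales auto
  \<comment> \<open>The index bounds stand under the existential so that choice yields one
    \<open>p\<close> defined for all \<open>i\<close> and \<open>j\<close>.\<close>
  have "\<forall>i j. \<exists>p. i < n \<longrightarrow> j < n \<longrightarrow> L $$ (i, j) = to_fract p \<and> poly_mapping.lookup p 0 = 0"
  proof (intro allI)
    fix i j
    show "\<exists>p. i < n \<longrightarrow> j < n \<longrightarrow> L $$ (i, j) = to_fract p \<and> poly_mapping.lookup p 0 = 0"
    proof (cases "i < n \<and> j < n")
      case True
      then have "L $$ (i, j) \<in> zero_const_fracts"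
        using L S by auto
      then show ?thesis by (auto simp: zero_const_fracts_def)
    qed auto
  qed
  then obtain p where p: "\<And>i j. i < n \<Longrightarrow> j < n \<Longrightarrow> L $$ (i, j) = to_fract (p i j)"
      "\<And>i j. i < n \<Longrightarrow> j < n \<Longrightarrow> poly_mapping.lookup (p i j) 0 = 0"
    by metis
  define P where "P = 1\<^sub>m n - mat n n (\<lambda>(i, j). p i j)"
  have "1\<^sub>m n - L = map_mat to_fract P"
    using L p(1) by (auto intro!: eq_matI simp: P_def)
  then have det: "det (1\<^sub>m n - L) = to_fract (det P)"
    by simp
  have "map_mat (\<lambda>p. poly_mapping.lookup p 0) P = 1\<^sub>m n"
    using p(2) by (auto intro!: eq_matI simp: P_def lookup_minus lookup_one)
  then have "poly_mapping.lookup (det P) 0 = 1"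
    by (metis \<phi>.hom_det det_one)
  then have "det P \<noteq> 0" by auto
  then show ?thesis using det by simp
qed

text \<open>The dimension conjunct strengthens the induction, since bounding the entries of a
  four-block matrix asks for matching block sizes.\<close>

lemma hcat_elements:
  assumes "\<And>A. A \<in> set As \<Longrightarrow> dim_row A = n \<and> elements_mat A \<subseteq> S"
  shows "elements_mat (hcat n As) \<subseteq> S \<and> dim_row (hcat n As) = n"
  using assms
proof (induction As)
  case (Cons A As)
  have "elements_mat (append_cols A (hcat n As)) \<subseteq>
      elements_mat A \<union> elements_mat (hcat n As) \<union> elements_mat (0\<^sub>m 0 (dim_col A))
        \<union> elements_mat (0\<^sub>m 0 (dim_col (hcat n As)))"
    unfolding append_cols_def using Cons
    by (intro elements_four_block_mat[of _ n "dim_col A" _ "dim_col (hcat n As)" _ 0]) auto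
  \<comment> \<open>The padding blocks have no rows, hence no entries.\<close>
  also have "\<dots> \<subseteq> S"
    using Cons by (auto simp: elements_mat_def[of "0\<^sub>m _ _"])
  finally show ?case using Cons by (simp add: append_cols_def)
qed auto

lemma vcat_elements:
  assumes "\<And>A. A \<in> set As \<Longrightarrow> dim_col A = n \<and> elements_mat A \<subseteq> S"
  shows "elements_mat (vcat n As) \<subseteq> S \<and> dim_col (vcat n As) = n"
  using assms
proof (induction As)
  case (Cons A As)
  have "elements_mat (A @\<^sub>r vcat n As) \<subseteq>
      elements_mat A \<union> elements_mat (0\<^sub>m (dim_row A) 0) \<union> elements_mat (vcat n As)
        \<union> elements_mat (0\<^sub>m (dim_row (vcat n As)) 0)"
    unfolding append_rows_def using Cons
    by (intro elements_four_block_mat[of _ "dim_row A" n _ 0 _ "dim_row (vcat n As)"]) auto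
  also have "\<dots> \<subseteq> S"
    using Cons by (auto simp: elements_mat_def[of "0\<^sub>m _ _"])
  finally show ?case using Cons by (simp add: append_rows_def)
qed auto

section \<open>Block products and the rank of the block system\<close>

lemma mat_uminus_mult_uminus:
  assumes "A \<in> carrier_mat n m" "B \<in> carrier_mat m k"
  shows "- A * - B = (A * B :: 'k::ring mat)"
  using assms by simp

text \<open>Both factors are four-block matrices padded with empty blocks. In their product three
  blocks are empty, and only the upper left one remains.\<close>

lemma append_cols_mult_append_rows:
  fixes A B C D :: "'k::semiring_0 mat"
  assumes "A \<in> carrier_mat n k" "B \<in> carrier_mat n l" "C \<in> carrier_mat k m" "D \<in> carrier_mat l m"
  shows "append_cols A B * (C @\<^sub>r D) = A * C + B * D"
proof -
  have "append_cols A B * (C @\<^sub>r D)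
      = four_block_mat (A * C + B * D) (A * 0\<^sub>m k 0 + B * 0\<^sub>m l 0)
          (0\<^sub>m 0 k * C + 0\<^sub>m 0 l * D) (0\<^sub>m 0 k * 0\<^sub>m k 0 + 0\<^sub>m 0 l * 0\<^sub>m l 0)"
    unfolding append_cols_def append_rows_def using assms
    by (subst mult_four_block_mat[of A n k B l _ 0 _ C m _ 0 D]) auto
  then show ?thesis
    using assms by (intro eq_matI) auto
qed

lemma append_cols_mult_four_block_mat:
  fixes A B C D E F :: "'k::semiring_0 mat"
  assumes "A \<in> carrier_mat n k" "B \<in> carrier_mat n l" "C \<in> carrier_mat k k'" "D \<in> carrier_mat k l'"
    "E \<in> carrier_mat l k'" "F \<in> carrier_mat l l'"
  shows "append_cols A B * four_block_mat C D E F = append_cols (A * C + B * E) (A * D + B * F)"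
proof -
  have "append_cols A B * four_block_mat C D E F
      = four_block_mat (A * C + B * E) (A * D + B * F)
          (0\<^sub>m 0 k * C + 0\<^sub>m 0 l * E) (0\<^sub>m 0 k * D + 0\<^sub>m 0 l * F)"
    unfolding append_cols_def using assms
    by (subst mult_four_block_mat[of A n k B l _ 0 _ C k' D l' E F]) auto
  then show ?thesis
    using assms by (intro eq_matI) (auto simp: append_cols_def)
qed

text \<open>\<open>P\<close> and \<open>Q\<close> stand for \<open>K_rx\<close> and
  \<open>K_tx\<close>, and \<open>W\<close> for the inverse of the identity minus the loop matrix.
  Eliminating the lower right block leaves the Schur complement
  \<open>- (P * (H + R * W * T) * Q)\<close>, whose sign does not affect the rank.\<close>

lemma mat_rank_block_system:
  fixes P H R W T Q L :: "'k::field mat"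
  assumes P: "P \<in> carrier_mat n p" and H: "H \<in> carrier_mat p q" and Q: "Q \<in> carrier_mat q n"
    and R: "R \<in> carrier_mat p r" and T: "T \<in> carrier_mat r q" and L: "L \<in> carrier_mat r r"
    and W: "W \<in> carrier_mat r r" and LW: "(1\<^sub>m r - L) * W = 1\<^sub>m r" and WL: "W * (1\<^sub>m r - L) = 1\<^sub>m r"
  shows "mat_rank (four_block_mat (0\<^sub>m n n) (append_cols (- P) (0\<^sub>m n r))
      ((- (H * Q)) @\<^sub>r (- (T * Q))) (four_block_mat (1\<^sub>m p) (- R) (0\<^sub>m r p) (1\<^sub>m r - L)))
    = mat_rank (P * (H + R * W * T) * Q) + (p + r)"
proof -
  let ?B = "append_cols (- P) (0\<^sub>m n r)"
  let ?C = "(- (H * Q)) @\<^sub>r (- (T * Q))"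
  let ?D = "four_block_mat (1\<^sub>m p) (- R) (0\<^sub>m r p) (1\<^sub>m r - L)"
  \<comment> \<open>The inverse of \<open>?D\<close>. Its corner \<open>Y\<close> is forced by
    \<open>Y - R * W = 0\<close>, the upper right block of \<open>?D * ?E\<close>.\<close>
  let ?E = "four_block_mat (1\<^sub>m p) (R * W) (0\<^sub>m r p) W"
  have M: "1\<^sub>m r - L \<in> carrier_mat r r" and nR: "- R \<in> carrier_mat p r" and RW: "R * W \<in> carrier_mat p r"
    and nP: "- P \<in> carrier_mat n p" and HQ: "H * Q \<in> carrier_mat p n" and TQ: "T * Q \<in> carrier_mat r n"
    and PRW: "P * (R * W) \<in> carrier_mat n r"
    using assms by auto
  have B: "?B \<in> carrier_mat n (p + r)" and C: "?C \<in> carrier_mat (p + r) n"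
    and D: "?D \<in> carrier_mat (p + r) (p + r)" and E: "?E \<in> carrier_mat (p + r) (p + r)"
    using nP HQ TQ M W by auto
  have "R * W * (1\<^sub>m r - L) = R"
    using assoc_mult_mat[OF R W M] WL right_mult_one_mat[OF R] by simp
  then have ED: "?E * ?D = 1\<^sub>m (p + r)"
    by (subst mult_four_block_mat[OF one_carrier_mat RW zero_carrier_mat W one_carrier_mat nR zero_carrier_mat M])
      (use R W M RW WL nR in \<open>auto simp: right_mult_zero_mat[OF W] right_mult_zero_mat[OF RW]
        left_mult_one_mat[OF nR] left_mult_zero_mat[OF nR]\<close>)
  have "- R * W = - (R * W)"
    using R W by simp
  moreover have "R * W + - (R * W) = 0\<^sub>m p r"
    by (rule mat_add_uminus[OF RW])
  ultimately have DE: "?D * ?E = 1\<^sub>m (p + r)"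
    by (subst mult_four_block_mat[OF one_carrier_mat nR zero_carrier_mat M one_carrier_mat RW zero_carrier_mat W])
      (use R W M RW LW nR in \<open>auto simp: right_mult_zero_mat[OF M] right_mult_zero_mat[OF nR]
        left_mult_one_mat[OF RW] left_mult_zero_mat[OF RW]\<close>)
  \<comment> \<open>The zero block of \<open>?B\<close> removes the second row of \<open>?E\<close>,
    leaving \<open>- P\<close> times the first row.\<close>
  have "?B * ?E = append_cols (- P) (- (P * (R * W)))"
    using P R W nP RW PRW
    by (subst append_cols_mult_four_block_mat[OF nP zero_carrier_mat one_carrier_mat RW zero_carrier_mat W])
      (auto simp: right_mult_one_mat[OF nP] left_mult_zero_mat[OF W])
  then have "?B * ?E * ?C = (- P) * (- (H * Q)) + (- (P * (R * W))) * (- (T * Q))"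
    using nP PRW HQ TQ by (simp add: append_cols_mult_append_rows[of _ n p _ r _ n])
  \<comment> \<open>Each product has two negated factors, so the signs cancel.\<close>
  also have "\<dots> = P * (H * Q) + (P * (R * W)) * (T * Q)"
    by (simp only: mat_uminus_mult_uminus[OF P HQ] mat_uminus_mult_uminus[OF PRW TQ])
  also have "\<dots> = P * (H + R * W * T) * Q"
  proof -
    have RWT: "R * W * T \<in> carrier_mat p q" using RW T by auto
    have "P * (H + R * W * T) * Q = (P * H + P * (R * W * T)) * Q"
      by (simp add: mult_add_distrib_mat[OF P H RWT])
    also have "\<dots> = P * H * Q + P * (R * W * T) * Q"
      by (rule add_mult_distrib_mat) (use P H RWT Q in auto)
    also have "P * H * Q = P * (H * Q)"
      by (rule assoc_mult_mat[OF P H Q])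
    also have "P * (R * W * T) * Q = P * (R * W) * (T * Q)"
      using assoc_mult_mat[OF P RW T] assoc_mult_mat[OF PRW T Q] by simp
    finally show ?thesis ..
  qed
  finally have "?B * ?E * ?C = P * (H + R * W * T) * Q" .
  \<comment> \<open>The upper left block of the system is zero, so the Schur complement is the
    negative of the product just computed.\<close>
  moreover have "0\<^sub>m n n - X = - X" if "X \<in> carrier_mat n n" for X :: "'k mat"
    using that by (intro eq_matI) auto
  moreover have "P * (H + R * W * T) * Q \<in> carrier_mat n n"
    using assms by auto
  ultimately show ?thesis
    using mat_rank_schur_complement[OF zero_carrier_mat B C D E DE ED] mat_rank_uminus by simp
qed


section \<open>Shapes and entries of the network matrices\<close>

lemma distinct_relay_list: "distinct (relay_list N)"
  and set_relay_list: "set (relay_list N) = {1..num_relays N}"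
  by (auto simp: relay_list_def)

lemma sum_list_relay_outputs: "(\<Sum>i\<leftarrow>relay_list N. outputs N (Relay i)) = relay_outputs N"
  by (simp add: sum_list_distinct_conv_sum_set[OF distinct_relay_list] set_relay_list relay_outputs_def)

lemma chan_carrier:
  assumes "is_lti_network N" "i = Tx \<or> i \<in> Relay ` set (relay_list N)"
    and "j = Rx \<or> j \<in> Relay ` set (relay_list N)"
  shows "chan N i j \<in> carrier_mat (outputs N j) (inputs N i)"
  using assms by (auto simp: is_lti_network_def set_relay_list chan_def)

lemma chan_mult_K_relay_carrier:
  assumes "is_lti_network N" "i \<in> set (relay_list N)" "j = Rx \<or> j \<in> Relay ` set (relay_list N)"
  shows "chan N (Relay i) j * K_relay X N i \<in> carrier_mat (outputs N j) (outputs N (Relay i))"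
  by (rule mult_carrier_mat[OF chan_carrier]) (use assms in \<open>auto simp: K_relay_def\<close>)

lemma relay_loop_carrier:
  assumes "is_lti_network N"
  shows "relay_loop X N \<in> carrier_mat (relay_outputs N) (relay_outputs N)"
proof -
  have "hcat (outputs N (Relay j)) [chan N (Relay i) (Relay j) * K_relay X N i. i \<leftarrow> relay_list N]
      \<in> carrier_mat (outputs N (Relay j)) (relay_outputs N)" if "j \<in> set (relay_list N)" for j
    unfolding sum_list_relay_outputs[symmetric] using that
    by (intro hcat_map_carrier chan_mult_K_relay_carrier[OF assms]) auto
  \<comment> \<open>Only the row count is rewritten as a sum of block heights; the width stays
    \<open>relay_outputs N\<close>, as \<open>vcat_map_carrier\<close> needs.\<close>
  then show ?thesis
    unfolding relay_loop_def by (subst (2) sum_list_relay_outputs[symmetric]) (rule vcat_map_carrier)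
qed

text \<open>Each entry is a sum of channel coefficients times single indeterminates, so it has no
  constant term.\<close>

lemma chan_mult_K_relay_elements:
  assumes "is_lti_network N" "i \<in> set (relay_list N)" "j = Rx \<or> j \<in> Relay ` set (relay_list N)"
  shows "elements_mat (chan N (Relay i) j * K_relay X N i) \<subseteq> zero_const_fracts"
proof
  fix x assume "x \<in> elements_mat (chan N (Relay i) j * K_relay X N i)"
  then obtain a b where "a < dim_row (chan N (Relay i) j * K_relay X N i)"
      "b < dim_col (chan N (Relay i) j * K_relay X N i)"
      and x: "x = (chan N (Relay i) j * K_relay X N i) $$ (a, b)"
    unfolding elements_mat_def by (auto simp del: index_mult_mat)
  then have "a < outputs N j" "b < outputs N (Relay i)"
    using chan_mult_K_relay_carrier[OF assms, of X] by (simp_all only: carrier_matD)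
  moreover note x
  moreover have "channel N (Relay i) j \<in> carrier_mat (outputs N j) (inputs N (Relay i))"
    using chan_carrier[OF assms(1), of "Relay i" j] assms(2,3) by (auto simp: chan_def)
  ultimately have "x = (\<Sum>k<inputs N (Relay i).
      const_gf (channel N (Relay i) j $$ (a, k)) * indet_gf (X (Relay_Entry i k b)))"
    by (simp add: chan_def K_relay_def scalar_prod_def atLeast0LessThan)
  then show "x \<in> zero_const_fracts"
    by (simp add: zero_const_fracts_sum const_mult_indet_in_zero_const_fracts)
qed

text \<open>The property passes from the blocks to the block rows and then to the whole matrix. It
  is what \<open>det_one_minus_nonzero\<close> asks of the loop matrix.\<close>

lemma relay_loop_elements:
  assumes "is_lti_network N"
  shows "elements_mat (relay_loop X N) \<subseteq> zero_const_fracts"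
proof -
  let ?h = "\<lambda>j. hcat (outputs N (Relay j)) [chan N (Relay i) (Relay j) * K_relay X N i. i \<leftarrow> relay_list N]"
  have "dim_col (?h j) = relay_outputs N \<and> elements_mat (?h j) \<subseteq> zero_const_fracts"
    if j: "j \<in> set (relay_list N)" for j
  proof
    have A: "chan N (Relay i) (Relay j) * K_relay X N i
        \<in> carrier_mat (outputs N (Relay j)) (outputs N (Relay i))" if "i \<in> set (relay_list N)" for i
      using j that by (intro chan_mult_K_relay_carrier[OF assms]) auto
    show "dim_col (?h j) = relay_outputs N"
      using hcat_map_carrier[of "relay_list N" _ _ "\<lambda>i. outputs N (Relay i)", OF A] by (simp add: sum_list_relay_outputs)
    have "dim_row B = outputs N (Relay j) \<and> elements_mat B \<subseteq> zero_const_fracts"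
      if "B \<in> set [chan N (Relay i) (Relay j) * K_relay X N i. i \<leftarrow> relay_list N]" for B
      using that A chan_mult_K_relay_elements[OF assms, of _ "Relay j" X] j by fastforce
    then show "elements_mat (?h j) \<subseteq> zero_const_fracts"
      using hcat_elements by blast
  qed
  then have "dim_col B = relay_outputs N \<and> elements_mat B \<subseteq> zero_const_fracts"
    if "B \<in> set (map ?h (relay_list N))" for B
    using that unfolding set_map by blast
  then show ?thesis
    unfolding relay_loop_def using vcat_elements by blast
qed

lemma relays_to_rx_carrier:
  assumes "is_lti_network N"
  shows "hcat (outputs N Rx) [chan N (Relay i) Rx * K_relay X N i. i \<leftarrow> relay_list N]
    \<in> carrier_mat (outputs N Rx) (relay_outputs N)"
  unfolding sum_list_relay_outputs[symmetric]
  by (intro hcat_map_carrier chan_mult_K_relay_carrier[OF assms]) auto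

lemma tx_to_relays_carrier:
  assumes "is_lti_network N"
  shows "vcat (inputs N Tx) [chan N Tx (Relay j). j \<leftarrow> relay_list N]
    \<in> carrier_mat (relay_outputs N) (inputs N Tx)"
  unfolding sum_list_relay_outputs[symmetric]
  by (intro vcat_map_carrier chan_carrier[OF assms]) auto

section \<open>Regrouping \<open>G_lin\<close> as a block system\<close>

text \<open>The first block row and column are set apart, and the receiver and all relays are merged
  into the lower right block. This is the form treated by
  \<open>mat_rank_block_system\<close>.\<close>

lemma G_lin_eq_four_block_mat:
  fixes N :: "('a::field) lti_network" and X :: "gain_entry \<Rightarrow> 'x::linorder"
  assumes N: "is_lti_network N"
  defines "H \<equiv> chan N Tx Rx"
    and "R \<equiv> hcat (outputs N Rx) [chan N (Relay i) Rx * K_relay X N i. i \<leftarrow> relay_list N]"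
    and "T \<equiv> vcat (inputs N Tx) [chan N Tx (Relay j). j \<leftarrow> relay_list N]"
    and "r \<equiv> relay_outputs N" and "p \<equiv> outputs N Rx"
  shows "G_lin X N d_ax = four_block_mat (0\<^sub>m d_ax d_ax) (append_cols (- K_rx X N d_ax) (0\<^sub>m d_ax r))
      ((- (H * K_tx X N d_ax)) @\<^sub>r (- (T * K_tx X N d_ax)))
      (four_block_mat (1\<^sub>m p) (- R) (0\<^sub>m r p) (1\<^sub>m r - relay_loop X N))"
proof -
  let ?js = "relay_list N" and ?c = "\<lambda>i. outputs N (Relay i)"
  let ?P = "K_rx X N d_ax" and ?Q = "K_tx X N d_ax"
  let ?A = "\<lambda>i j. chan N (Relay i) (Relay j) * K_relay X N i :: ('x, 'a) gain_field mat"
  \<comment> \<open>\<open>?h j\<close> is the relay part of the block row of relay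
    \<open>j\<close>.\<close>
  let ?h = "\<lambda>j. hcat (?c j) (map (\<lambda>i. if i = j then 1\<^sub>m (?c j) - ?A j j else - ?A i j) ?js)"
  have r: "(\<Sum>i\<leftarrow>?js. ?c i) = r"
    by (simp add: r_def sum_list_relay_outputs)
  have Q: "?Q \<in> carrier_mat (inputs N Tx) d_ax" and P: "?P \<in> carrier_mat d_ax p"
    by (auto simp: K_tx_def K_rx_def p_def)
  have A: "?A i j \<in> carrier_mat (?c j) (?c i)" if "i \<in> set ?js" "j \<in> set ?js" for i j
    using that by (intro chan_mult_K_relay_carrier[OF N]) auto
  have RA: "chan N (Relay i) Rx * K_relay X N i \<in> carrier_mat p (?c i)" if "i \<in> set ?js" for i
    unfolding p_def using that by (intro chan_mult_K_relay_carrier[OF N]) auto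
  have TA: "chan N Tx (Relay j) \<in> carrier_mat (?c j) (inputs N Tx)" if "j \<in> set ?js" for j
    using that by (intro chan_carrier[OF N]) auto
  have R: "R \<in> carrier_mat p r"
    unfolding R_def p_def r_def by (rule relays_to_rx_carrier[OF N])
  have T: "T \<in> carrier_mat r (inputs N Tx)"
    unfolding T_def r_def by (rule tx_to_relays_carrier[OF N])
  have H: "H \<in> carrier_mat p (inputs N Tx)"
    unfolding H_def p_def by (intro chan_carrier[OF N]) auto
  have h: "?h j \<in> carrier_mat (?c j) r" if "j \<in> set ?js" for j
    unfolding r[symmetric] using A that by (intro hcat_map_carrier) (auto simp: minus_carrier_mat)
  have TQ: "- (chan N Tx (Relay j) * ?Q) \<in> carrier_mat (?c j) d_ax" if "j \<in> set ?js" for j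
    using mult_carrier_mat[OF TA[OF that] Q] by simp
  have L: "1\<^sub>m r - relay_loop X N \<in> carrier_mat r r"
    using relay_loop_carrier[OF N, of X] by (simp add: r_def minus_carrier_mat)
  have nHQ: "- (H * ?Q) \<in> carrier_mat p d_ax" and nTQ: "- (T * ?Q) \<in> carrier_mat r d_ax"
    and nP: "- ?P \<in> carrier_mat d_ax p" and nR: "- R \<in> carrier_mat p r"
    using H T Q P R by auto

  have "hcat p (map (\<lambda>i. - (chan N (Relay i) Rx * K_relay X N i)) ?js) = - R"
    unfolding R_def p_def[symmetric] by (rule hcat_map_uminus) (rule RA)
  \<comment> \<open>The relay rows are split into block columns twice: first after the
    \<open>d_ax\<close> leading columns, then after the \<open>p\<close> receiver columns.\<close>
  moreover have "vcat (d_ax + p + r)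
      (map (\<lambda>j. append_cols (- (chan N Tx (Relay j) * ?Q)) (append_cols (0\<^sub>m (?c j) p) (?h j))) ?js)
    = append_cols (- (T * ?Q)) (append_cols (0\<^sub>m r p) (1\<^sub>m r - relay_loop X N))"
  proof -
    \<comment> \<open>The width is bracketed to match the nesting of \<open>append_cols\<close> and
      reassociated at the end.\<close>
    have "vcat (d_ax + (p + r))
        (map (\<lambda>j. append_cols (- (chan N Tx (Relay j) * ?Q)) (append_cols (0\<^sub>m (?c j) p) (?h j))) ?js)
      = append_cols (vcat d_ax (map (\<lambda>j. - (chan N Tx (Relay j) * ?Q)) ?js))
          (vcat (p + r) (map (\<lambda>j. append_cols (0\<^sub>m (?c j) p) (?h j)) ?js))"
      by (rule vcat_map_append_cols[where c = ?c]) (auto intro!: append_cols_carrier TQ h simp del: uminus_carrier_iff_mat)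
    also have "vcat d_ax (map (\<lambda>j. - (chan N Tx (Relay j) * ?Q)) ?js) = - (T * ?Q)"
      unfolding T_def
      by (subst vcat_map_uminus[where c = ?c])
        (use mult_carrier_mat[OF TA Q] in \<open>simp_all add: vcat_map_mult[where c = ?c, OF TA Q]\<close>)
    also have "vcat (p + r) (map (\<lambda>j. append_cols (0\<^sub>m (?c j) p) (?h j)) ?js)
        = append_cols (vcat p (map (\<lambda>j. 0\<^sub>m (?c j) p) ?js)) (vcat r (map ?h ?js))"
      by (rule vcat_map_append_cols[where c = ?c]) (auto intro!: h)
    also have "vcat p (map (\<lambda>j. 0\<^sub>m (?c j) p) ?js) = 0\<^sub>m r p"
      by (simp only: vcat_map_zero r)
    also have "vcat r (map ?h ?js) = 1\<^sub>m r - relay_loop X N"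
      using vcat_hcat_one_minus[of ?js ?A ?c, OF distinct_relay_list A]
      by (simp add: r sum_list_relay_outputs relay_loop_def flip: r_def)
    finally show ?thesis by (simp only: add.assoc)
  qed
  moreover have "hcat d_ax (map (\<lambda>i. 0\<^sub>m d_ax (?c i)) ?js) = (0\<^sub>m d_ax r :: ('x, 'a) gain_field mat)"
    by (simp only: hcat_map_zero r)
  ultimately have "G_lin X N d_ax = append_cols (0\<^sub>m d_ax d_ax) (append_cols (- ?P) (0\<^sub>m d_ax r)) @\<^sub>r
      (append_cols (- (H * ?Q)) (append_cols (1\<^sub>m p) (- R)) @\<^sub>r
       append_cols (- (T * ?Q)) (append_cols (0\<^sub>m r p) (1\<^sub>m r - relay_loop X N)))"
    by (simp add: G_lin_def flip: p_def r_def H_def)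
  \<comment> \<open>The interchange law merges the receiver row with the relay rows: both sides are
    the same \<open>four_block_mat\<close>.\<close>
  also have "append_cols (- (H * ?Q)) (append_cols (1\<^sub>m p) (- R)) @\<^sub>r
       append_cols (- (T * ?Q)) (append_cols (0\<^sub>m r p) (1\<^sub>m r - relay_loop X N))
     = append_cols ((- (H * ?Q)) @\<^sub>r (- (T * ?Q)))
         (append_cols (1\<^sub>m p) (- R) @\<^sub>r append_cols (0\<^sub>m r p) (1\<^sub>m r - relay_loop X N))"
    unfolding append_rows_append_cols[OF nHQ append_cols_carrier[OF one_carrier_mat nR] nTQ append_cols_carrier[OF zero_carrier_mat L]]
      append_cols_append_rows[OF nHQ append_cols_carrier[OF one_carrier_mat nR] nTQ append_cols_carrier[OF zero_carrier_mat L]] ..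
  also have "append_cols (1\<^sub>m p) (- R) @\<^sub>r append_cols (0\<^sub>m r p) (1\<^sub>m r - relay_loop X N)
      = four_block_mat (1\<^sub>m p) (- R) (0\<^sub>m r p) (1\<^sub>m r - relay_loop X N)"
    by (rule append_rows_append_cols[OF one_carrier_mat nR zero_carrier_mat L])
  finally show "G_lin X N d_ax = four_block_mat (0\<^sub>m d_ax d_ax) (append_cols (- ?P) (0\<^sub>m d_ax r))
      ((- (H * ?Q)) @\<^sub>r (- (T * ?Q)))
      (four_block_mat (1\<^sub>m p) (- R) (0\<^sub>m r p) (1\<^sub>m r - relay_loop X N))"
    by (simp only: append_rows_append_cols[OF zero_carrier_mat append_cols_carrier[OF nP zero_carrier_mat]
        carrier_append_rows[OF nHQ nTQ] four_block_carrier_mat[OF one_carrier_mat L]])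
qed

theorem lemma3:
  fixes N :: "('a::field) lti_network"
    and X :: "gain_entry \<Rightarrow> 'x::linorder"
    and d_ax d :: nat
  assumes "is_lti_network N"
    and "0 < d_ax"
    and "inj_on X (gain_entries N d_ax)"
    and "d = outputs N Rx + (\<Sum>i = 1..num_relays N. outputs N (Relay i))"
  shows "mat_rank (K_rx X N d_ax * transfer_matrix X N * K_tx X N d_ax) + d
       = mat_rank (G_lin X N d_ax)"
proof -
  define r where "r = relay_outputs N"
  define M where "M = 1\<^sub>m r - relay_loop X N"
  have L: "relay_loop X N \<in> carrier_mat r r"
    using relay_loop_carrier[OF assms(1)] by (simp add: r_def)
  then have M: "M \<in> carrier_mat r r" by (simp add: M_def minus_carrier_mat)
  have "det M \<noteq> 0"
    unfolding M_def by (rule det_one_minus_nonzero[OF L relay_loop_elements[OF assms(1)]])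
  then have "M \<in> Units (ring_mat TYPE(('x, 'a) gain_field) r ())"
    by (rule det_non_zero_imp_unit[OF M])
  \<comment> \<open>A unit excludes the result \<open>None\<close>, so the \<open>the\<close> in
    \<open>transfer_matrix\<close> yields the actual inverse and not an unspecified value.\<close>
  then obtain W where "mat_inverse M = Some W"
    using mat_inverse(1)[OF M, where b = "()"] by (cases "mat_inverse M") auto
  then have W: "the (mat_inverse M) \<in> carrier_mat r r"
    and MW: "M * the (mat_inverse M) = 1\<^sub>m r" and WM: "the (mat_inverse M) * M = 1\<^sub>m r"
    using mat_inverse(2)[OF M] by auto
  have P: "K_rx X N d_ax \<in> carrier_mat d_ax (outputs N Rx)"
    and Q: "K_tx X N d_ax \<in> carrier_mat (inputs N Tx) d_ax"
    by (auto simp: K_rx_def K_tx_def)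
  have H: "chan N Tx Rx \<in> carrier_mat (outputs N Rx) (inputs N Tx)"
    using assms(1) by (intro chan_carrier) auto
  note R = relays_to_rx_carrier[OF assms(1), of X, folded r_def]
  note T = tx_to_relays_carrier[OF assms(1), folded r_def]
  \<comment> \<open>The size \<open>outputs N Rx + r\<close> of the eliminated block is
    \<open>d\<close>.\<close>
  show ?thesis
    unfolding G_lin_eq_four_block_mat[OF assms(1), folded r_def]
      mat_rank_block_system[OF P H Q R T L W[unfolded M_def] MW[unfolded M_def] WM[unfolded M_def]]
    using assms(4) by (simp add: transfer_matrix_def M_def r_def relay_outputs_def)
qed

end
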